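(* Let $p\in\{0,1\}$. As formal power series in $x$ with coefficients in $\mathbb{Z}[y,z]$, the series $\sum_{n,m,r}s_{[p]}(n,m,r)x^ny^mz^r$ equals $$\frac{2x^4z^2\big(y^{[\![p=0]\!]}-1\big)+x^3z(z+1)y^{[\![p=1]\!]}-x^2(z^2+1)\big(y^{[\![p=0]\!]}-2\big)-x(z+1)y^{[\![p=1]\!]}-2}{x^4z^2\big(y^{2[\![p=0]\!]}-1\big)+x^3z(z+1)\,y^{[\![p=0]\!]+[\![p=1]\!]}+x^2\big(zy^{2[\![p=1]\!]}+z^2+1\big)-1}.$$
   Context: $[\![P]\!]$ is the Iverson bracket ($1$ if $P$ is true, $0$ otherwise). An $n$-string is a binary string of length $n$; its Hamming weight is its number of ones. A (nonnull) run is a maximal block, of length at least $1$, of consecutive equal bits; it is a $p$-parity run if its length is congruent to $p$ modulo $2$. For $n\ge 1$, $s_{[p]}(n,m,r)$ is the number of $n$-strings of Hamming weight $r$ in which the total number of $p$-parity runs of ones and $p$-parity runs of zeros is exactly $m$. By convention $s_{[p]}(0,m,r)=2$ if $m=r=0$ and $0$ otherwise (the sum of two contributions, one per starting bit, each initialised as $1$), and the quantity is $0$ if $n<0$, $m<0$ or $r<0$. The sum is over all integers $n,m,r$. *)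

theory Defs
  imports "HOL-Computational_Algebra.Formal_Power_Series" "HOL-Computational_Algebra.Polynomial"
    "HOL-Number_Theory.Cong"
begin

text \<open>Binary strings are lists of type \<^typ>\<open>bool list\<close>, with \<^term>\<open>True\<close> standing for 1.
  A run is recorded by its starting position and its length.\<close>

definition runs :: "bool \<Rightarrow> bool list \<Rightarrow> (nat \<times> nat) set" where
  "runs b w = {(i, l). 1 \<le> l \<and> i + l \<le> length w \<and> (\<forall>k\<in>{i..<i + l}. w ! k = b) \<and>
      (i = 0 \<or> w ! (i - 1) \<noteq> b) \<and> (i + l = length w \<or> w ! (i + l) \<noteq> b)}"

definition parity_runs :: "nat \<Rightarrow> bool \<Rightarrow> bool list \<Rightarrow> (nat \<times> nat) set" where
  "parity_runs p b w = {(i, l) \<in> runs b w. [l = p] (mod 2)}"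

definition hamming_weight :: "bool list \<Rightarrow> nat" where
  "hamming_weight w = count_list w True"

text \<open>For \<open>n = 0\<close> the value is a convention (one contribution per starting bit), not the number of
  empty strings.\<close>

definition num_strings :: "nat \<Rightarrow> nat \<Rightarrow> nat \<Rightarrow> nat \<Rightarrow> nat" where
  "num_strings p n m r =
    (if n = 0 then (if m = 0 \<and> r = 0 then 2 else 0)
     else card {w. length w = n \<and> hamming_weight w = r \<and>
                   card (parity_runs p True w) + card (parity_runs p False w) = m})"

text \<open>The ring of polynomials in \<open>y\<close>, \<open>z\<close> over the integers is \<^typ>\<open>int poly poly\<close>, with \<open>z\<close> the
  outer variable.\<close>

definition var_y :: "int poly poly" where "var_y = [:[:0, 1:]:]"

definition var_z :: "int poly poly" where "var_z = [:0, 1:]"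

text \<open>Bounding \<open>m\<close> and \<open>r\<close> by \<open>n\<close> omits only zero terms; see \<open>coeff_strings_gf\<close> below.\<close>

definition strings_gf :: "nat \<Rightarrow> int poly poly fps" where
  "strings_gf p =
    Abs_fps (\<lambda>n. \<Sum>m\<le>n. \<Sum>r\<le>n. of_nat (num_strings p n m r) * var_y ^ m * var_z ^ r)"

lemma card_runs_le:
  "card (parity_runs p True w) + card (parity_runs p False w) \<le> length w"
proof -
  define A where "A = parity_runs p True w"
  define B where "B = parity_runs p False w"
  have sub: "A \<subseteq> runs True w" "B \<subseteq> runs False w"
    by (auto simp: A_def B_def parity_runs_def)
  have same: "l = l'" if "(i, l) \<in> runs b w" "(i, l') \<in> runs b w" for i l l' b
  proof (rule ccontr)
    assume "l \<noteq> l'"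
    then consider "l < l'" | "l' < l" by linarith
    then show False using that by cases (auto simp: runs_def)
  qed
  have iA: "inj_on fst A" and iB: "inj_on fst B"
    using sub same by (fastforce intro!: inj_onI)+
  have bit: "w ! i = b \<and> i < length w" if "(i, l) \<in> runs b w" for i l b
    using that by (auto simp: runs_def)
  have bA: "w ! i \<and> i < length w" if "i \<in> fst ` A" for i
    using that sub(1) bit[of i _ True] by auto
  have bB: "\<not> w ! i \<and> i < length w" if "i \<in> fst ` B" for i
    using that sub(2) bit[of i _ False] by auto
  have img: "fst ` A \<union> fst ` B \<subseteq> {..<length w}" and disj: "fst ` A \<inter> fst ` B = {}"
    using bA bB by blast+
  have "card A + card B = card (fst ` A) + card (fst ` B)"
    using iA iB by (simp add: card_image)
  also have "\<dots> = card (fst ` A \<union> fst ` B)"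
    using img disj by (subst card_Un_disjoint) (auto intro: finite_subset)
  also have "\<dots> \<le> card {..<length w}"
    using img by (intro card_mono) auto
  finally show ?thesis by (simp add: A_def B_def)
qed

lemma num_strings_eq_0:
  assumes "n < m \<or> n < r"
  shows "num_strings p n m r = 0"
proof (cases "n = 0")
  case False
  have "{w. length w = n \<and> hamming_weight w = r \<and>
          card (parity_runs p True w) + card (parity_runs p False w) = m} = {}"
    using assms card_runs_le[of p] count_le_length[of _ True]
    by (auto simp: hamming_weight_def not_le[symmetric])
  then show ?thesis using False unfolding num_strings_def by (simp only: if_False card.empty)
qed (use assms in \<open>auto simp: num_strings_def\<close>)

lemma monomial_yz:
  "of_nat c * var_y ^ m * var_z ^ r = monom (monom (int c) m) r"
proof -
  have "var_y ^ m = [:monom 1 m:]"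
    by (induction m) (auto simp: var_y_def monom_Suc one_pCons mult_ac)
  moreover have "var_z ^ r = monom 1 r"
    by (induction r) (simp_all add: var_z_def monom_Suc)
  ultimately show ?thesis
    by (simp add: of_nat_poly smult_monom)
qed

lemma coeff_strings_gf:
  "coeff (coeff (fps_nth (strings_gf p) n) r) m = int (num_strings p n m r)"
proof -
  have "coeff (coeff (fps_nth (strings_gf p) n) r) m
      = (\<Sum>m'\<le>n. \<Sum>r'\<le>n. if r' = r then (if m' = m then int (num_strings p n m' r') else 0) else 0)"
    by (auto simp: strings_gf_def monomial_yz coeff_sum intro!: sum.cong)
  also have "\<dots> = (if m \<le> n \<and> r \<le> n then int (num_strings p n m r) else 0)"
    by (auto simp: sum.delta cong: if_cong)
  finally show ?thesis
    using num_strings_eq_0[of n m r p] by (auto simp: not_le)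
qed

end

theory Submission imports Defs begin

text \<open>
  Give a string \<open>w\<close> the weight \<open>y ^ m * z ^ r\<close>, where \<open>m\<close> counts its \<open>p\<close>-parity runs and \<open>r\<close> is
  its Hamming weight. A string is an alternating sequence of runs, and its weight is the product
  of the weights of the runs (\<open>weight_replicate_append\<close>). Let \<open>A\<^sub>b\<close> be the generating function of
  the strings that are empty or start with \<open>b\<close>, and \<open>R\<^sub>b\<close> that of the single runs of \<open>b\<close>. Splitting
  off the first run gives \<open>A\<^sub>b = 1 + R\<^sub>b * A\<^sub>c\<close>, where \<open>c\<close> is the other bit (\<open>from_gf_first_run\<close>).
  Since the empty string belongs to both families, \<open>A\<^sub>1 + A\<^sub>0\<close> has constant term 2, which is
  precisely the convention for \<open>n = 0\<close>; so the series in question is \<open>A\<^sub>1 + A\<^sub>0\<close>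
  (\<open>strings_gf_eq\<close>), and the two equations yield
  \<open>(A\<^sub>1 + A\<^sub>0) * (1 - R\<^sub>1 * R\<^sub>0) = 2 + R\<^sub>1 + R\<^sub>0\<close>.

  The runs of each parity of length contribute to \<open>R\<^sub>b\<close> a geometric series of ratio \<open>u\<^sup>2\<close>, with \<open>u = x * z\<close> for ones and \<open>u = x\<close> for
  zeros, so \<open>R\<^sub>b * (1 - u\<^sup>2)\<close> is a polynomial (\<open>run_gf_closed_form\<close>). Multiplying by
  \<open>- (1 - x\<^sup>2 * z\<^sup>2) * (1 - x\<^sup>2)\<close> turns the last equation into the claimed one. The denominator
  has constant term \<open>-1\<close>, hence is a unit.
\<close>

section \<open>Run statistics under removal of the first run\<close>

lemma finite_runs: "finite (runs c w)"
  by (rule finite_subset[of _ "{..length w} \<times> {..length w}"]) (auto simp: runs_def)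

text \<open>Because \<open>v\<close> does not continue the initial block of \<open>b\<close>, the cut between the block and \<open>v\<close> is
  a run boundary: the block is a full run and no run of \<open>v\<close> changes except for its position.\<close>

lemma runs_replicate_append:
  assumes l: "0 < l" and v: "v = [] \<or> hd v \<noteq> b"
  shows "runs c (replicate l b @ v) =
    (if c = b then {(0, l)} else {}) \<union> (\<lambda>(i, k). (i + l, k)) ` runs c v"
proof (intro set_eqI iffI)
  have v0: "v ! 0 \<noteq> b" if "0 < length v"
    using v that by (auto simp: hd_conv_nth)
  define w where "w = replicate l b @ v"
  have len: "length w = l + length v" by (simp add: w_def)
  have lo: "w ! i = b" if "i < l" for i
    using that by (simp add: w_def nth_append)
  have hi: "w ! (j + l) = v ! j" for j
    by (simp add: w_def nth_append)
  fix q
  {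
    assume "q \<in> runs c (replicate l b @ v)"
    then obtain i k where q: "q = (i, k)" and k: "1 \<le> k" "i + k \<le> length w"
      and eq: "\<And>j. i \<le> j \<Longrightarrow> j < i + k \<Longrightarrow> w ! j = c"
      and st: "i = 0 \<or> w ! (i - 1) \<noteq> c" and en: "i + k = length w \<or> w ! (i + k) \<noteq> c"
      unfolding w_def[symmetric] by (auto simp: runs_def)
    show "q \<in> (if c = b then {(0, l)} else {}) \<union> (\<lambda>(i, k). (i + l, k)) ` runs c v"
    proof (cases "i < l")
      case True
      have cb: "c = b" using eq[of i] lo[OF True] k by simp
      have i0: "i = 0" using st lo[of "i - 1"] True cb by auto
      have "\<not> l < k"
      proof
        assume lk: "l < k"
        then have "0 < length v" using k i0 len by linarith
        then show False using eq[of l] hi[of 0] v0 lk i0 cb by simp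
      qed
      moreover have "\<not> k < l" using en lo[of k] i0 cb len by auto
      ultimately show ?thesis using q i0 cb by auto
    next
      case False
      then obtain j where j: "i = j + l" by (metis le_Suc_ex add.commute not_less)
      have "(j, k) \<in> runs c v"
        unfolding runs_def
      proof (clarify, intro conjI)
        show "1 \<le> k" "j + k \<le> length v" using k len j by auto
        show "\<forall>m\<in>{j..<j + k}. v ! m = c"
        proof
          fix m assume "m \<in> {j..<j + k}"
          then show "v ! m = c" using eq[of "m + l"] hi[of m] j by auto
        qed
        show "j = 0 \<or> v ! (j - 1) \<noteq> c"
          using st hi[of "j - 1"] j l by (cases j) auto
        show "j + k = length v \<or> v ! (j + k) \<noteq> c"
          using en hi[of "j + k"] j len by (auto simp: algebra_simps)
      qed
      then show ?thesis using q j by force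
    qed
  next
    assume "q \<in> (if c = b then {(0, l)} else {}) \<union> (\<lambda>(i, k). (i + l, k)) ` runs c v"
    then consider "c = b" "q = (0, l)" | j k where "q = (j + l, k)" "(j, k) \<in> runs c v"
      by (auto split: if_splits)
    then show "q \<in> runs c (replicate l b @ v)"
    proof cases
      case 1
      then show ?thesis
        unfolding w_def[symmetric]
        using l lo len hi[of 0] v0 by (auto simp: runs_def)
    next
      case 2
      then have k: "1 \<le> k" "j + k \<le> length v"
        and eq: "\<And>m. j \<le> m \<Longrightarrow> m < j + k \<Longrightarrow> v ! m = c"
        and st: "j = 0 \<or> v ! (j - 1) \<noteq> c" and en: "j + k = length v \<or> v ! (j + k) \<noteq> c"
        by (auto simp: runs_def)
      show ?thesis
        unfolding w_def[symmetric] runs_def \<open>q = (j + l, k)\<close>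
      proof (clarify, intro conjI)
        show "1 \<le> k" "j + l + k \<le> length w" using k len by auto
        show "\<forall>m\<in>{j + l..<j + l + k}. w ! m = c"
        proof
          fix m assume "m \<in> {j + l..<j + l + k}"
          then have "j \<le> m - l" "m - l < j + k" "m - l + l = m" by auto
          then show "w ! m = c" using eq[of "m - l"] hi[of "m - l"] by simp
        qed
        show "j + l = 0 \<or> w ! (j + l - 1) \<noteq> c"
        proof (cases j)
          case 0
          \<comment> \<open>A run at the front of \<open>v\<close> has the bit opposite to \<open>b\<close>, so it is not
            prolonged to the left.\<close>
          have "0 < length v" using k by linarith
          then have "c \<noteq> b" using eq[of 0] v0 k 0 by simp
          then show ?thesis using lo[of "l - 1"] l 0 by auto
        next
          case (Suc j')
          then show ?thesis using st hi[of j'] by auto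
        qed
        show "j + l + k = length w \<or> w ! (j + l + k) \<noteq> c"
          using en hi[of "j + k"] len by (auto simp: algebra_simps)
      qed
    qed
  }
qed

lemma card_parity_runs_replicate_append:
  assumes "0 < l" and "v = [] \<or> hd v \<noteq> b"
  shows "card (parity_runs p c (replicate l b @ v)) =
    of_bool (c = b \<and> [l = p] (mod 2)) + card (parity_runs p c v)"
proof -
  let ?A = "if c = b \<and> [l = p] (mod 2) then {(0, l)} else {}"
  let ?B = "(\<lambda>(i, k). (i + l, k)) ` parity_runs p c v"
  have "parity_runs p c (replicate l b @ v) = ?A \<union> ?B"
    using assms by (auto simp: parity_runs_def runs_replicate_append split: if_splits)
  moreover have "?A \<inter> ?B = {}"
    using assms(1) by auto
  moreover have "finite (parity_runs p c v)"
    by (rule finite_subset[OF _ finite_runs[of c v]]) (auto simp: parity_runs_def)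
  moreover have "card ?B = card (parity_runs p c v)"
    by (rule card_image) (auto intro!: inj_onI)
  ultimately show ?thesis
    by (simp add: card_Un_disjoint)
qed

section \<open>Weights of strings and of runs\<close>

definition weight :: "nat \<Rightarrow> bool list \<Rightarrow> int poly poly" where
  "weight p w = var_y ^ (card (parity_runs p True w) + card (parity_runs p False w))
    * var_z ^ hamming_weight w"

lemma weight_Nil: "weight p [] = 1"
proof -
  have "parity_runs p c [] = {}" for c
    by (auto simp: parity_runs_def runs_def)
  then show ?thesis by (simp add: weight_def hamming_weight_def)
qed

lemma hamming_weight_replicate_append:
  "hamming_weight (replicate l b @ v) = of_bool b * l + hamming_weight v"
  by (induction l) (auto simp: hamming_weight_def)

text \<open>Multiplicativity along run boundaries; this turns concatenation of runs into multiplication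
  of generating functions.\<close>

lemma weight_replicate_append:
  assumes "0 < l" and "v = [] \<or> hd v \<noteq> b"
  shows "weight p (replicate l b @ v) =
    var_y ^ of_bool ([l = p] (mod 2)) * var_z ^ (of_bool b * l) * weight p v"
  using card_parity_runs_replicate_append[OF assms]
  by (cases b) (auto simp: weight_def hamming_weight_replicate_append power_add algebra_simps)

section \<open>Generating functions by first bit\<close>

text \<open>The empty string belongs to the family of either bit: it is what remains after the last run
  has been split off, whichever bit that run had.\<close>

definition strings_from :: "bool \<Rightarrow> nat \<Rightarrow> bool list set" where
  "strings_from b n = {w. length w = n \<and> (w = [] \<or> hd w = b)}"

definition from_gf :: "nat \<Rightarrow> bool \<Rightarrow> int poly poly fps" where
  "from_gf p b = Abs_fps (\<lambda>n. \<Sum>w\<in>strings_from b n. weight p w)"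

definition run_gf :: "nat \<Rightarrow> bool \<Rightarrow> int poly poly fps" where
  "run_gf p b = Abs_fps (\<lambda>l. if l = 0 then 0
     else var_y ^ of_bool ([l = p] (mod 2)) * var_z ^ (of_bool b * l))"

lemma finite_strings: "finite {w :: bool list. length w = n}"
  using finite_lists_length_eq[of "UNIV :: bool set" n] by simp

lemma finite_strings_from: "finite (strings_from b n)"
  by (rule finite_subset[OF _ finite_strings[of n]]) (auto simp: strings_from_def)

text \<open>The first run of a nonempty string is its longest prefix of equal bits, so the string
  determines the splitting. The bound \<open>1 \<le> l\<close> keeps the first run nonempty.\<close>

lemma bij_betw_first_run:
  assumes "0 < n"
  shows "bij_betw (\<lambda>(l, v). replicate l b @ v)
    (SIGMA l:{1..n}. strings_from (\<not> b) (n - l)) (strings_from b n)"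
proof (rule bij_betw_byWitness)
  let ?S = "SIGMA l:{1..n}. strings_from (\<not> b) (n - l)"
  let ?f = "\<lambda>(l, v). replicate l b @ v"
  let ?g = "\<lambda>w. (length (takeWhile ((=) b) w), dropWhile ((=) b) w)"
  have rest: "takeWhile ((=) b) v = []" "dropWhile ((=) b) v = v"
    if "v = [] \<or> hd v = (\<not> b)" for v
    using that by (cases v; auto)+
  show "\<forall>q\<in>?S. ?g (?f q) = q"
    by (auto simp: strings_from_def takeWhile_append dropWhile_append rest)
  have repl: "replicate (length (takeWhile ((=) b) w)) b = takeWhile ((=) b) w" for w
    by (induction w) auto
  show "\<forall>w\<in>strings_from b n. ?f (?g w) = w"
    by (simp add: repl)
  show "?f ` ?S \<subseteq> strings_from b n"
  proof clarify
    fix l v assume "l \<in> {1..n}" "v \<in> strings_from (\<not> b) (n - l)"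
    then show "replicate l b @ v \<in> strings_from b n"
      by (cases l) (auto simp: strings_from_def)
  qed
  show "?g ` strings_from b n \<subseteq> ?S"
  proof (rule image_subsetI)
    fix w assume w: "w \<in> strings_from b n"
    then have "w \<noteq> []" "hd w = b"
      using assms by (auto simp: strings_from_def)
    then have "0 < length (takeWhile ((=) b) w)"
      by (cases w) auto
    moreover have len: "length (takeWhile ((=) b) w) + length (dropWhile ((=) b) w) = n"
      using w by (metis (mono_tags, lifting) length_append mem_Collect_eq strings_from_def
          takeWhile_dropWhile_id)
    ultimately have "length (takeWhile ((=) b) w) \<in> {1..n}"
      by (metis One_nat_def Suc_leI atLeastAtMost_iff le_add1)
    moreover have "length (dropWhile ((=) b) w) = n - length (takeWhile ((=) b) w)"
      using len by linarith
    moreover have "dropWhile ((=) b) w = [] \<or> hd (dropWhile ((=) b) w) = (\<not> b)"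
      using hd_dropWhile[of "(=) b" w] by (cases b) blast+
    ultimately show "?g w \<in> ?S"
      unfolding strings_from_def by blast
  qed
qed

text \<open>The Cauchy product sums over the length of the first run; the term 1 is the empty string.\<close>

lemma from_gf_first_run: "from_gf p b = 1 + run_gf p b * from_gf p (\<not> b)"
proof (rule fps_ext)
  fix n
  show "fps_nth (from_gf p b) n = fps_nth (1 + run_gf p b * from_gf p (\<not> b)) n"
  proof (cases "n = 0")
    case True
    moreover have "strings_from b 0 = {[]}" by (auto simp: strings_from_def)
    ultimately show ?thesis by (simp add: from_gf_def run_gf_def weight_Nil)
  next
    case False
    have "fps_nth (from_gf p b) n = (\<Sum>w\<in>strings_from b n. weight p w)"
      by (simp add: from_gf_def)
    also have "\<dots> = (\<Sum>(l, v)\<in>(SIGMA l:{1..n}. strings_from (\<not> b) (n - l)).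
        weight p (replicate l b @ v))"
      using sum.reindex_bij_betw[OF bij_betw_first_run, of n "weight p" b] False
      by (simp add: case_prod_unfold)
    also have "\<dots> = (\<Sum>l=1..n. \<Sum>v\<in>strings_from (\<not> b) (n - l). weight p (replicate l b @ v))"
      by (subst sum.Sigma) (auto simp: finite_strings_from)
    also have "\<dots> = (\<Sum>l=1..n. fps_nth (run_gf p b) l * fps_nth (from_gf p (\<not> b)) (n - l))"
    proof (rule sum.cong[OF refl])
      fix l assume l: "l \<in> {1..n}"
      have "weight p (replicate l b @ v) = fps_nth (run_gf p b) l * weight p v"
        if "v \<in> strings_from (\<not> b) (n - l)" for v
        using that l weight_replicate_append[of l v b p]
        by (auto simp: strings_from_def run_gf_def)
      then show "(\<Sum>v\<in>strings_from (\<not> b) (n - l). weight p (replicate l b @ v)) =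
          fps_nth (run_gf p b) l * fps_nth (from_gf p (\<not> b)) (n - l)"
        by (simp add: from_gf_def sum_distrib_left)
    qed
    also have "\<dots> = (\<Sum>l=0..n. fps_nth (run_gf p b) l * fps_nth (from_gf p (\<not> b)) (n - l))"
      by (rule sum.mono_neutral_left) (auto simp: run_gf_def)
    finally show ?thesis
      using False by (simp add: fps_mult_nth)
  qed
qed

text \<open>Grouping the strings by the two statistics. The box \<open>{..n} \<times> {..n}\<close> captures all of them,
  since a string has at most as many runs, and ones, as it has bits.\<close>

lemma sum_num_strings:
  assumes "0 < n"
  shows "(\<Sum>m\<le>n. \<Sum>r\<le>n. of_nat (num_strings p n m r) * var_y ^ m * var_z ^ r)
    = (\<Sum>w | length w = n. weight p w)"
proof -
  let ?c = "\<lambda>w. card (parity_runs p True w) + card (parity_runs p False w)"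
  let ?st = "\<lambda>w. (?c w, hamming_weight w)"
  let ?L = "{w :: bool list. length w = n}"
  have "(\<Sum>w\<in>?L. weight p w) =
      (\<Sum>q\<in>{..n} \<times> {..n}. \<Sum>w\<in>{w \<in> ?L. ?st w = q}. weight p w)"
  proof (rule sum.group[symmetric])
    show "?st ` ?L \<subseteq> {..n} \<times> {..n}"
      using card_runs_le[of p] count_le_length[of _ True] by (auto simp: hamming_weight_def)
  qed (auto simp: finite_strings)
  also have "\<dots> = (\<Sum>(m, r)\<in>{..n} \<times> {..n}. of_nat (num_strings p n m r) * var_y ^ m * var_z ^ r)"
  proof (rule sum.cong[OF refl], clarify)
    fix m r
    have "{w \<in> ?L. ?st w = (m, r)} =
        {w. length w = n \<and> hamming_weight w = r \<and> ?c w = m}"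
      by auto
    then have "card {w \<in> ?L. ?st w = (m, r)} = num_strings p n m r"
      using assms by (simp only: num_strings_def) simp
    moreover have "(\<Sum>w\<in>{w \<in> ?L. ?st w = (m, r)}. weight p w) =
        (\<Sum>w\<in>{w \<in> ?L. ?st w = (m, r)}. var_y ^ m * var_z ^ r)"
      by (rule sum.cong) (auto simp: weight_def)
    ultimately show "(\<Sum>w\<in>{w \<in> ?L. ?st w = (m, r)}. weight p w) =
        of_nat (num_strings p n m r) * var_y ^ m * var_z ^ r"
      by (simp only: sum_constant mult.assoc)
  qed
  also have "\<dots> = (\<Sum>m\<le>n. \<Sum>r\<le>n. of_nat (num_strings p n m r) * var_y ^ m * var_z ^ r)"
    by (simp add: sum.cartesian_product)
  finally show ?thesis by simp
qed

text \<open>Nonempty strings are split by their first bit. In degree 0 the empty string is counted once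
  for each bit, which matches the conventional value 2.\<close>

lemma strings_gf_eq: "strings_gf p = from_gf p True + from_gf p False"
proof (rule fps_ext)
  fix n
  show "fps_nth (strings_gf p) n = fps_nth (from_gf p True + from_gf p False) n"
  proof (cases "n = 0")
    case True
    moreover have "strings_from b 0 = {[]}" for b by (auto simp: strings_from_def)
    ultimately show ?thesis
      by (simp add: from_gf_def weight_Nil strings_gf_def num_strings_def)
  next
    case False
    have "{w. length w = n} = strings_from True n \<union> strings_from False n"
      by (auto simp: strings_from_def)
    moreover have "strings_from True n \<inter> strings_from False n = {}"
      using False by (auto simp: strings_from_def)
    ultimately show ?thesis
      using False sum_num_strings[of n p]
      by (simp add: from_gf_def strings_gf_def sum.union_disjoint finite_strings_from)
  qed
qed

section \<open>Rational form\<close>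

text \<open>Lengthening a run by two keeps its parity and multiplies its term by \<open>u\<^sup>2\<close>, so after
  multiplication by \<open>1 - u\<^sup>2\<close> only the terms of the runs of lengths 1 and 2 survive.\<close>

lemma run_gf_closed_form:
  fixes p :: nat and b :: bool
  assumes "p \<in> {0, 1}"
  defines "u \<equiv> fps_X * fps_const var_z ^ of_bool b"
  shows "run_gf p b * (1 - u ^ 2) =
    u * fps_const var_y ^ of_bool (p = 1) + u ^ 2 * fps_const var_y ^ of_bool (p = 0)"
proof (rule fps_ext)
  fix n
  let ?t = "var_z ^ of_bool b"
  have u: "u ^ 2 = fps_X ^ 2 * fps_const (?t ^ 2)" "u = fps_X * fps_const ?t"
    by (auto simp: u_def power_mult_distrib)
  \<comment> \<open>The recurrence starts at length 1, as the coefficient at 0 is set to 0.\<close>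
  have step: "fps_nth (run_gf p b) (Suc (Suc (Suc l))) = fps_nth (run_gf p b) (Suc l) * ?t ^ 2" for l
    by (cases b) (auto simp: run_gf_def cong_def power2_eq_square mult_ac)
  have lhs: "fps_nth (run_gf p b * (1 - u ^ 2)) n =
      fps_nth (run_gf p b) n - (if n < 2 then 0 else fps_nth (run_gf p b) (n - 2) * ?t ^ 2)"
  proof -
    have "run_gf p b * (1 - u ^ 2) =
        run_gf p b - fps_X ^ 2 * (run_gf p b * fps_const (?t ^ 2))"
      unfolding u(1) by (simp only: right_diff_distrib mult_1_right mult_1_left mult_ac)
    then show ?thesis by (simp add: fps_X_power_mult_nth)
  qed
  have rhs: "fps_nth (u * fps_const var_y ^ of_bool (p = 1) +
        u ^ 2 * fps_const var_y ^ of_bool (p = 0)) n =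
      (if n = 1 then ?t * var_y ^ of_bool (p = 1) else 0) +
      (if n = 2 then ?t ^ 2 * var_y ^ of_bool (p = 0) else 0)"
    unfolding u(1) unfolding u(2)
    by (auto simp: mult.assoc fps_X_power_mult_nth)
  consider "n = 0" | "n = 1" | "n = 2" | l where "n = Suc (Suc (Suc l))"
    by (metis One_nat_def Suc_1 not0_implies_Suc)
  then show "fps_nth (run_gf p b * (1 - u ^ 2)) n =
      fps_nth (u * fps_const var_y ^ of_bool (p = 1) + u ^ 2 * fps_const var_y ^ of_bool (p = 0)) n"
  proof cases
    case 4
    then show ?thesis using lhs rhs step[of l] by simp
  qed (use lhs rhs assms(1) in \<open>auto simp: run_gf_def cong_def\<close>)
qed

text \<open>The two linear equations give \<open>(A + B) * (1 - Q * R) = 2 + Q + R\<close>; multiplying by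
  \<open>- (1 - (x * z)\<^sup>2) * (1 - x\<^sup>2)\<close> makes \<open>Q\<close> and \<open>R\<close> disappear.\<close>

lemma rational_form_of_sum:
  fixes x z s t A B Q R :: "'a :: comm_ring_1"
  assumes A: "A = 1 + Q * B" and B: "B = 1 + R * A"
    and Q: "Q * (1 - (x * z) ^ 2) = x * z * s + (x * z) ^ 2 * t"
    and R: "R * (1 - x ^ 2) = x * s + x ^ 2 * t"
  shows "(A + B) * (x ^ 4 * z ^ 2 * (t ^ 2 - 1) + x ^ 3 * z * (z + 1) * (t * s)
      + x ^ 2 * (z * s ^ 2 + z ^ 2 + 1) - 1) =
    2 * x ^ 4 * z ^ 2 * (t - 1) + x ^ 3 * z * (z + 1) * s
      - x ^ 2 * (z ^ 2 + 1) * (t - 2) - x * (z + 1) * s - 2"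
    (is "_ * ?D = ?N")
proof -
  let ?a = "1 - (x * z) ^ 2" and ?b = "1 - x ^ 2"
  have "(A + B) * (1 - Q * R) = (A - Q * (R * A)) + (B - R * (Q * B))"
    by (simp add: algebra_simps)
  also have "\<dots> = (A - Q * (B - 1)) + (B - R * (A - 1))"
    using A B by (metis add_diff_cancel_left')
  also have "\<dots> = (A - Q * B) + (B - R * A) + Q + R"
    by (simp add: algebra_simps)
  also have "\<dots> = 2 + Q + R"
    using A B by (metis add_diff_cancel_right' one_add_one)
  finally have sum_AB: "(A + B) * (1 - Q * R) = 2 + Q + R" .
  have "?D = - (?a * ?b - (x * z * s + (x * z) ^ 2 * t) * (x * s + x ^ 2 * t))"
    by (simp add: algebra_simps power2_eq_square power3_eq_cube power4_eq_xxxx)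
  also have "\<dots> = - (?a * ?b * (1 - Q * R))"
    unfolding Q[symmetric] R[symmetric] by (simp add: algebra_simps)
  finally have "(A + B) * ?D = - (?a * ?b * ((A + B) * (1 - Q * R)))"
    by (simp only: mult_minus_right mult.left_commute)
  also have "\<dots> = - (2 * ?a * ?b + Q * ?a * ?b + R * ?b * ?a)"
    unfolding sum_AB by (simp only: distrib_left distrib_right mult_ac)
  also have "\<dots> = ?N"
    unfolding Q R
    by (simp add: algebra_simps power2_eq_square power3_eq_cube power4_eq_xxxx)
  finally show ?thesis .
qed

lemma dvd_one_fps_if_nth_0:
  fixes f :: "'a :: comm_ring_1 fps"
  assumes "fps_nth f 0 * c = 1"
  shows "f dvd 1"
  using fps_right_inverse[OF assms] by (metis dvd_triv_left)

theorem mainTheorem17: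
  fixes p :: nat
  assumes "p \<in> {0, 1}"
  shows "let x = (fps_X :: int poly poly fps);
             y = fps_const var_y;
             z = fps_const var_z;
             N = 2 * x ^ 4 * z ^ 2 * (y ^ of_bool (p = 0) - 1)
                 + x ^ 3 * z * (z + 1) * y ^ of_bool (p = 1)
                 - x ^ 2 * (z ^ 2 + 1) * (y ^ of_bool (p = 0) - 2)
                 - x * (z + 1) * y ^ of_bool (p = 1)
                 - 2;
             D = x ^ 4 * z ^ 2 * (y ^ (2 * of_bool (p = 0)) - 1)
                 + x ^ 3 * z * (z + 1) * y ^ (of_bool (p = 0) + of_bool (p = 1))
                 + x ^ 2 * (z * y ^ (2 * of_bool (p = 1)) + z ^ 2 + 1)
                 - 1
         in D dvd 1 \<and> strings_gf p * D = N"
proof -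
  define x where "x = (fps_X :: int poly poly fps)"
  define y where "y = fps_const var_y"
  define z where "z = fps_const var_z"
  define s where "s = y ^ of_bool (p = 1)"
  define t where "t = y ^ of_bool (p = 0)"
  let ?N = "2 * x ^ 4 * z ^ 2 * (t - 1) + x ^ 3 * z * (z + 1) * s
      - x ^ 2 * (z ^ 2 + 1) * (t - 2) - x * (z + 1) * s - 2"
  let ?D = "x ^ 4 * z ^ 2 * (t ^ 2 - 1) + x ^ 3 * z * (z + 1) * (t * s)
      + x ^ 2 * (z * s ^ 2 + z ^ 2 + 1) - 1"
  have pows: "y ^ (2 * of_bool (p = 0)) = t ^ 2" "y ^ (2 * of_bool (p = 1)) = s ^ 2"
    "y ^ (of_bool (p = 0) + of_bool (p = 1)) = t * s"
    by (simp_all add: s_def t_def power_add mult.commute flip: power_mult)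
  have "strings_gf p * ?D = ?N"
    unfolding strings_gf_eq
  proof (rule rational_form_of_sum)
    show "from_gf p True = 1 + run_gf p True * from_gf p False"
      and "from_gf p False = 1 + run_gf p False * from_gf p True"
      using from_gf_first_run[of p True] from_gf_first_run[of p False]
      unfolding not_True_eq_False not_False_eq_True .
    show "run_gf p True * (1 - (x * z) ^ 2) = x * z * s + (x * z) ^ 2 * t"
      and "run_gf p False * (1 - x ^ 2) = x * s + x ^ 2 * t"
      using run_gf_closed_form[OF assms, of True] run_gf_closed_form[OF assms, of False]
      by (simp_all add: x_def y_def z_def s_def t_def)
  qed
  moreover have "?D dvd 1"
    by (rule dvd_one_fps_if_nth_0[of _ "-1"]) (simp add: x_def fps_mult_nth_0 power_0_left)
  ultimately show ?thesis
    unfolding Let_def x_def[symmetric] y_def[symmetric] z_def[symmetric] pows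
    by (simp only: s_def t_def simp_thms)
qed

end
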